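(* Consider the SDP pair and ADMM iteration of the context, with $\mathcal A$ surjective and nonempty KKT set, and suppose the ADMM iterates converge to a KKT point $(X_\star,y_\star,S_\star)$ with $\operatorname{rank}X_\star+\operatorname{rank}S_\star=n$. Then there exists $\bar k_{\mathrm{ID}}\in\mathbb N$ such that for every integer $k\ge\bar k_{\mathrm{ID}}$, $\operatorname{rank}X^{(k)}=\operatorname{rank}X_\star$ and $\operatorname{rank}S^{(k)}=\operatorname{rank}S_\star$.
   Context: $\mathbb S^n$: real symmetric matrices; $\Pi_{\mathbb S^n_+}$ the Frobenius projection onto the PSD cone. SDP pair: minimize $\langle C,X\rangle$ s.t. $\mathcal AX=b$, $X\succeq0$; maximize $b^\top y$ s.t. $\mathcal A^*y+S=C$, $S\succeq0$, where $C,A_1,\dots,A_m\in\mathbb S^n$, $\mathcal AX=(\operatorname{tr}(A_iX))_i$, $\mathcal A^*y=\sum y_iA_i$. KKT point: $\mathcal AX=b$, $\mathcal A^*y+S=C$, $\operatorname{tr}(XS)=0$, $X,S\succeq0$. With $\sigma>0$ and $\mathcal P=\mathcal A^*(\mathcal A\mathcal A^* )^{-1}\mathcal A$, ADMM (one-step form) iterates $Z^{(k+1)}=\mathcal P(-2\Pi_{\mathbb S^n_+}(Z^{(k)})+Z^{(k)})+\Pi_{\mathbb S^n_+}(Z^{(k)})+\mathcal A^*(\mathcal A\mathcal A^* )^{-1}b+\sigma\mathcal PC-\sigma C$ and $X^{(k)}=\Pi_{\mathbb S^n_+}(Z^{(k)})$, $S^{(k)}=\sigma^{-1}\Pi_{\mathbb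 S^n_+}(-Z^{(k)})$; convergence of the iterates to $(X_\star,y_\star,S_\star)$ means $Z^{(k)}\to X_\star-\sigma S_\star$ (equivalently, the classical three-step ADMM iterates converge to that KKT point). *)

theory Defs
  imports "HOL-Analysis.Analysis"
begin

(* Matrices in S^n are real^'n^'n with transpose X = X.
   The norm on real^'n^'n is the Frobenius norm. *)

definition sym_mat :: "real^'n^'n \<Rightarrow> bool" where
  "sym_mat X \<longleftrightarrow> transpose X = X"

definition psd :: "real^'n^'n \<Rightarrow> bool" where
  "psd X \<longleftrightarrow> sym_mat X \<and> (\<forall>v. 0 \<le> v \<bullet> (X *v v))"

(* Frobenius inner product <X,Y> = tr(X Y) (for symmetric X) *)
definition frob :: "real^'n^'n \<Rightarrow> real^'n^'n \<Rightarrow> real" where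
  "frob X Y = trace (transpose X ** Y)"

(* Frobenius projection onto the PSD cone: the unique nearest PSD matrix *)
definition psd_proj :: "real^'n^'n \<Rightarrow> real^'n^'n" where
  "psd_proj Z = (THE X. psd X \<and> (\<forall>Y. psd Y \<longrightarrow> norm (Z - X) \<le> norm (Z - Y)))"

(* the linear map \<A>X = (tr(A_i X))_i and its adjoint A-star *)
definition Aop :: "('m::finite \<Rightarrow> real^'n^'n) \<Rightarrow> real^'n^'n \<Rightarrow> real^'m" where
  "Aop A X = (\<chi> i. frob (A i) X)"

definition Aadj :: "('m::finite \<Rightarrow> real^'n^'n) \<Rightarrow> real^'m \<Rightarrow> real^'n^'n" where
  "Aadj A y = (\<Sum>i\<in>UNIV. (y $ i) *\<^sub>R A i)"

(* Gram matrix of A (matrix of A A-adjoint) and its inverse *)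
definition AAt :: "('m::finite \<Rightarrow> real^'n^'n) \<Rightarrow> real^'m^'m" where
  "AAt A = (\<chi> i j. frob (A i) (A j))"

definition AAt_inv :: "('m::finite \<Rightarrow> real^'n^'n) \<Rightarrow> real^'m \<Rightarrow> real^'m" where
  "AAt_inv A b = matrix_inv (AAt A) *v b"

(* P = Aadj o inverse Gram o Aop *)
definition Pproj :: "('m::finite \<Rightarrow> real^'n^'n) \<Rightarrow> real^'n^'n \<Rightarrow> real^'n^'n" where
  "Pproj A X = Aadj A (AAt_inv A (Aop A X))"

definition is_KKT ::
  "('m::finite \<Rightarrow> real^'n^'n) \<Rightarrow> real^'m \<Rightarrow> real^'n^'n \<Rightarrow>
   real^'n^'n \<Rightarrow> real^'m \<Rightarrow> real^'n^'n \<Rightarrow> bool" where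
  "is_KKT A b C X y S \<longleftrightarrow> Aop A X = b \<and> Aadj A y + S = C \<and> trace (X ** S) = 0
      \<and> psd X \<and> psd S"

(* one-step ADMM map *)
definition admm_step ::
  "('m::finite \<Rightarrow> real^'n^'n) \<Rightarrow> real^'m \<Rightarrow> real^'n^'n \<Rightarrow> real \<Rightarrow> real^'n^'n \<Rightarrow> real^'n^'n" where
  "admm_step A b C \<sigma> Z = Pproj A (Z - 2 *\<^sub>R psd_proj Z) + psd_proj Z
      + Aadj A (AAt_inv A b) + \<sigma> *\<^sub>R Pproj A C - \<sigma> *\<^sub>R C"

definition admm_X :: "real^'n^'n \<Rightarrow> real^'n^'n" where
  "admm_X Z = psd_proj Z"

definition admm_S :: "real \<Rightarrow> real^'n^'n \<Rightarrow> real^'n^'n" where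
  "admm_S \<sigma> Z = inverse \<sigma> *\<^sub>R psd_proj (- Z)"

end

theory Submission
  imports Defs
begin

text \<open>
  The projection onto the PSD cone is continuous, and complementarity
  \<open>Xs \<bullet> Ss = 0\<close> says exactly that it maps \<open>Xs - \<sigma> Ss\<close> to \<open>Xs\<close> and \<open>\<sigma> Ss - Xs\<close>
  to \<open>\<sigma> Ss\<close>; hence the iterates \<open>X\<^sub>k\<close>, \<open>S\<^sub>k\<close> converge to \<open>Xs\<close>, \<open>Ss\<close>. Rank is lower
  semicontinuous, so eventually \<open>rank X\<^sub>k \<ge> rank Xs\<close> and \<open>rank S\<^sub>k \<ge> rank Ss\<close>.
  Conversely, by Moreau's decomposition the PSD parts of a symmetric \<open>Z\<close> and of
  \<open>-Z\<close> are PSD with vanishing inner product, hence have orthogonal ranges, so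
  \<open>rank X\<^sub>k + rank S\<^sub>k \<le> n = rank Xs + rank Ss\<close>, which forces equality.
\<close>

section \<open>Symmetric and positive semidefinite matrices\<close>

lemma sym_mat_iff: "sym_mat X \<longleftrightarrow> (\<forall>i j. X $ i $ j = X $ j $ i)"
  unfolding sym_mat_def transpose_def vec_eq_iff by auto

lemma sym_mat_add: "sym_mat X \<Longrightarrow> sym_mat Y \<Longrightarrow> sym_mat (X + Y)"
  by (simp add: sym_mat_iff)

lemma sym_mat_diff: "sym_mat X \<Longrightarrow> sym_mat Y \<Longrightarrow> sym_mat (X - Y)"
  by (simp add: sym_mat_iff)

lemma sym_mat_scaleR: "sym_mat X \<Longrightarrow> sym_mat (c *\<^sub>R X)"
  by (simp add: sym_mat_iff)

lemma sym_mat_sum: "(\<And>i. i \<in> I \<Longrightarrow> sym_mat (f i)) \<Longrightarrow> sym_mat (sum f I)"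
  by (induction I rule: infinite_finite_induct) (auto simp: sym_mat_iff)

lemma sym_mat_Aadj: "(\<And>i. sym_mat (A i)) \<Longrightarrow> sym_mat (Aadj A y)"
  unfolding Aadj_def by (intro sym_mat_sum sym_mat_scaleR)

lemma sym_mat_inner_mult: "sym_mat S \<Longrightarrow> x \<bullet> (S *v y) = (S *v x) \<bullet> y"
  by (metis dot_lmul_matrix sym_mat_def transpose_matrix_vector)

lemma inner_matrix_eq_sum: "(X::real^'n^'m) \<bullet> Y = (\<Sum>i\<in>UNIV. \<Sum>j\<in>UNIV. X $ i $ j * Y $ i $ j)"
  by (simp add: inner_vec_def inner_real_def)

lemma trace_mult_sym_mat: "sym_mat S \<Longrightarrow> trace (X ** S) = X \<bullet> S"
  by (simp add: trace_def inner_matrix_eq_sum matrix_matrix_mult_def sym_mat_iff)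

lemma psd_zero: "psd 0"
  by (simp add: psd_def sym_mat_iff)

lemma psd_add: "psd X \<Longrightarrow> psd Y \<Longrightarrow> psd (X + Y)"
  by (simp add: psd_def sym_mat_add matrix_vector_mult_add_rdistrib inner_add_right add_nonneg_nonneg)

lemma psd_scaleR: "psd X \<Longrightarrow> 0 \<le> c \<Longrightarrow> psd (c *\<^sub>R X)"
  by (simp add: psd_def sym_mat_scaleR scaleR_matrix_vector_assoc[symmetric])

definition outer :: "real^'n \<Rightarrow> real^'n \<Rightarrow> real^'n^'n" where
  "outer u v = (\<chi> i j. u $ i * v $ j)"

lemma outer_mult_vec: "outer u v *v x = (v \<bullet> x) *\<^sub>R u"
  by (simp add: outer_def inner_vec_def matrix_vector_mult_def vec_eq_iff sum_distrib_left ac_simps)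

lemma matrix_mult_outer: "S ** outer u v = outer (S *v u) v"
  by (simp add: outer_def matrix_matrix_mult_def matrix_vector_mult_def vec_eq_iff sum_distrib_left ac_simps)

lemma outer_zero_left [simp]: "outer 0 v = 0"
  by (simp add: outer_def vec_eq_iff)

lemma inner_outer: "S \<bullet> outer u u = u \<bullet> (S *v u)"
  by (simp add: inner_matrix_eq_sum outer_def inner_vec_def matrix_vector_mult_def sum_distrib_left ac_simps)

lemma psd_outer: "psd (outer u u)"
proof -
  have "sym_mat (outer u u)" by (simp add: sym_mat_iff outer_def)
  then show ?thesis by (simp add: psd_def outer_mult_vec inner_commute)
qed

lemma quadratic_nonneg_imp_discrim_le:
  fixes a b c :: real
  assumes nonneg: "\<And>t. 0 \<le> a + 2 * b * t + c * t\<^sup>2" and "0 \<le> c"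
  shows "b\<^sup>2 \<le> a * c"
proof (cases "c = 0")
  case True
  have "b = 0"
  proof (rule ccontr)
    assume "b \<noteq> 0"
    then show False
      using nonneg[of "- (a + 1) / (2 * b)"] True by (simp add: field_simps)
  qed
  with True show ?thesis by simp
next
  case False
  with \<open>0 \<le> c\<close> have "0 < c" by simp
  have "0 \<le> c * (a + 2 * b * (- b / c) + c * (- b / c)\<^sup>2)"
    using nonneg[of "- b / c"] \<open>0 < c\<close> by simp
  also have "\<dots> = a * c - b\<^sup>2"
    using \<open>0 < c\<close> by (simp add: field_simps power2_eq_square)
  finally show ?thesis by simp
qed

lemma psd_Cauchy_Schwarz:
  assumes "psd Y"
  shows "(x \<bullet> (Y *v z))\<^sup>2 \<le> (x \<bullet> (Y *v x)) * (z \<bullet> (Y *v z))"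
proof (rule quadratic_nonneg_imp_discrim_le)
  have sym: "sym_mat Y" and quad: "\<And>v. 0 \<le> v \<bullet> (Y *v v)"
    using assms unfolding psd_def by auto
  have zx: "z \<bullet> (Y *v x) = x \<bullet> (Y *v z)"
    using sym_mat_inner_mult[OF sym, of z x] by (simp add: inner_commute)
  show "0 \<le> z \<bullet> (Y *v z)" by (rule quad)
  fix t
  have "(x + t *\<^sub>R z) \<bullet> (Y *v (x + t *\<^sub>R z))
      = x \<bullet> (Y *v x) + 2 * (x \<bullet> (Y *v z)) * t + (z \<bullet> (Y *v z)) * t\<^sup>2"
    using zx by (simp add: matrix_vector_right_distrib matrix_vector_mult_scaleR
        inner_add_left inner_add_right algebra_simps power2_eq_square)
  then show "0 \<le> x \<bullet> (Y *v x) + 2 * (x \<bullet> (Y *v z)) * t + (z \<bullet> (Y *v z)) * t\<^sup>2"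
    using quad by metis
qed

lemma psd_quadratic_eq_0_imp_mult_eq_0:
  assumes "psd S" "x \<bullet> (S *v x) = 0"
  shows "S *v x = 0"
proof -
  have "((S *v x) \<bullet> (S *v x))\<^sup>2 \<le> 0"
    using psd_Cauchy_Schwarz[OF assms(1), of "S *v x" x] assms(2) by simp
  then show ?thesis by simp
qed

lemma psd_nonzero_obtains_pos_quadratic:
  assumes "psd Y" "Y \<noteq> 0"
  obtains e where "0 < e \<bullet> (Y *v e)"
proof (rule ccontr)
  assume "\<not> thesis"
  with that have "e \<bullet> (Y *v e) = 0" for e
    using assms(1) unfolding psd_def by (meson antisym not_le)
  then have "Y *v e = 0 *v e" for e
    using psd_quadratic_eq_0_imp_mult_eq_0[OF assms(1)] by simp
  with assms(2) show False by (simp add: matrix_eq)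
qed

lemma rank_less_of_range_psubset:
  fixes A B :: "real^'n^'m"
  assumes "range ((*v) A) \<subset> range ((*v) B)"
  shows "rank A < rank B"
proof -
  have "subspace (range ((*v) C))" for C :: "real^'n^'m"
    by (rule linear_subspace_image) auto
  then have "span (range ((*v) C)) = range ((*v) C)" for C :: "real^'n^'m"
    by simp
  then show ?thesis
    using assms unfolding rank_dim_range by (metis dim_psubset)
qed

lemma outer_scaleR: "outer (a *\<^sub>R u) (a *\<^sub>R v) = (a * a) *\<^sub>R outer u v"
  by (simp add: outer_def vec_eq_iff)

lemma psd_diff_rank_one:
  assumes psdY: "psd Y" and q_pos: "0 < e \<bullet> (Y *v e)"
  shows "psd (Y - (1 / (e \<bullet> (Y *v e))) *\<^sub>R outer (Y *v e) (Y *v e))"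
    (is "psd ?Y'")
proof -
  define q where "q = e \<bullet> (Y *v e)"
  have sym: "sym_mat Y"
    using psdY unfolding psd_def by simp
  have "0 \<le> x \<bullet> (?Y' *v x)" for x
  proof -
    have "(e \<bullet> (Y *v x))\<^sup>2 \<le> q * (x \<bullet> (Y *v x))"
      unfolding q_def by (rule psd_Cauchy_Schwarz[OF psdY])
    moreover have "x \<bullet> (?Y' *v x) = x \<bullet> (Y *v x) - (e \<bullet> (Y *v x))\<^sup>2 / q"
      using sym_mat_inner_mult[OF sym, of e x] unfolding q_def
      by (simp add: matrix_vector_mult_diff_rdistrib outer_mult_vec scaleR_matrix_vector_assoc[symmetric]
          inner_diff_right inner_commute[of x] power2_eq_square)
    ultimately have "0 \<le> q * (x \<bullet> (?Y' *v x))"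
      using q_pos unfolding q_def by (simp add: field_simps)
    then show ?thesis
      using q_pos unfolding q_def by (simp add: zero_le_mult_iff)
  qed
  moreover have "sym_mat ?Y'"
    using sym psd_outer unfolding psd_def by (blast intro: sym_mat_diff sym_mat_scaleR)
  ultimately show ?thesis
    unfolding psd_def by simp
qed

lemma range_diff_rank_one_psubset:
  assumes sym: "sym_mat Y" and q_nz: "e \<bullet> (Y *v e) \<noteq> 0"
  shows "range ((*v) (Y - (1 / (e \<bullet> (Y *v e))) *\<^sub>R outer (Y *v e) (Y *v e))) \<subset> range ((*v) Y)"
    (is "range ((*v) ?Y') \<subset> _")
proof
  define q where "q = e \<bullet> (Y *v e)"
  have Y'_mult: "?Y' *v x = Y *v (x - ((Y *v e) \<bullet> x / q) *\<^sub>R e)" for x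
    unfolding q_def by (simp add: matrix_vector_mult_diff_rdistrib matrix_vector_mult_diff_distrib
        outer_mult_vec matrix_vector_mult_scaleR scaleR_matrix_vector_assoc[symmetric])
  then show "range ((*v) ?Y') \<subseteq> range ((*v) Y)"
    by auto
  have "(Y *v e) \<bullet> e = e \<bullet> (Y *v e)"
    by (rule inner_commute)
  with q_nz have Y'_e: "?Y' *v e = 0"
    by (simp add: matrix_vector_mult_diff_rdistrib outer_mult_vec scaleR_matrix_vector_assoc[symmetric])
  have "sym_mat ?Y'"
    using sym by (simp add: sym_mat_iff outer_def)
  have "Y *v e \<notin> range ((*v) ?Y')"
  proof
    assume "Y *v e \<in> range ((*v) ?Y')"
    then obtain z where "Y *v e = ?Y' *v z"
      by blast
    then have "e \<bullet> (Y *v e) = (?Y' *v e) \<bullet> z"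
      using sym_mat_inner_mult[OF \<open>sym_mat ?Y'\<close>, of e z] by simp
    with Y'_e q_nz show False
      by simp
  qed
  then show "range ((*v) ?Y') \<noteq> range ((*v) Y)"
    by auto
qed

lemma psd_eq_sum_outer:
  assumes "psd Y"
  shows "\<exists>us. Y = (\<Sum>u\<leftarrow>us. outer u u)"
  using assms
proof (induction "rank Y" arbitrary: Y rule: less_induct)
  case less
  show ?case
  proof (cases "Y = 0")
    case True
    then show ?thesis by (metis sum_list.Nil list.map(1))
  next
    case False
    with less.prems obtain e where q_pos: "0 < e \<bullet> (Y *v e)"
      by (rule psd_nonzero_obtains_pos_quadratic)
    define w where "w = (1 / sqrt (e \<bullet> (Y *v e))) *\<^sub>R (Y *v e)"
    have w: "outer w w = (1 / (e \<bullet> (Y *v e))) *\<^sub>R outer (Y *v e) (Y *v e)"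
      using q_pos unfolding w_def outer_scaleR by (simp add: real_sqrt_mult[symmetric])
    have "psd (Y - outer w w)"
      unfolding w by (rule psd_diff_rank_one[OF less.prems q_pos])
    moreover have "rank (Y - outer w w) < rank Y"
      unfolding w using less.prems q_pos unfolding psd_def
      by (intro rank_less_of_range_psubset range_diff_rank_one_psubset) auto
    ultimately obtain us where "Y - outer w w = (\<Sum>u\<leftarrow>us. outer u u)"
      using less.hyps by blast
    then have "Y = (\<Sum>u\<leftarrow>w # us. outer u u)"
      by (simp add: algebra_simps)
    then show ?thesis ..
  qed
qed

lemma inner_sum_outer: "S \<bullet> (\<Sum>u\<leftarrow>us. outer u u) = (\<Sum>u\<leftarrow>us. u \<bullet> (S *v u))"
  by (induction us) (simp_all add: inner_add_right inner_outer)

lemma matrix_mult_sum_outer: "S ** (\<Sum>u\<leftarrow>us. outer u u) = (\<Sum>u\<leftarrow>us. outer (S *v u) u)"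
  by (induction us) (simp_all add: matrix_add_ldistrib matrix_mult_outer)

lemma psd_inner_nonneg:
  assumes "psd S" "psd Y"
  shows "0 \<le> S \<bullet> Y"
proof -
  obtain us where "Y = (\<Sum>u\<leftarrow>us. outer u u)"
    using psd_eq_sum_outer[OF assms(2)] ..
  with assms(1) show ?thesis
    unfolding psd_def by (auto simp: inner_sum_outer intro!: sum_list_nonneg)
qed

lemma psd_inner_eq_0_imp_mult_eq_0:
  assumes psdS: "psd S" and "psd Y" and "S \<bullet> Y = 0"
  shows "S ** Y = 0"
proof -
  obtain us where Y: "Y = (\<Sum>u\<leftarrow>us. outer u u)"
    using psd_eq_sum_outer[OF assms(2)] ..
  have "\<forall>u\<in>set us. u \<bullet> (S *v u) = 0"
    using \<open>S \<bullet> Y = 0\<close> psdS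
    unfolding Y inner_sum_outer psd_def by (subst (asm) sum_list_nonneg_eq_0_iff) auto
  then have "\<forall>u\<in>set us. S *v u = 0"
    using psd_quadratic_eq_0_imp_mult_eq_0[OF psdS] by blast
  then show ?thesis
    unfolding Y matrix_mult_sum_outer by (induction us) auto
qed

lemma rank_add_rank_le_of_psd_inner_eq_0:
  fixes P W :: "real^'n^'n"
  assumes psdP: "psd P" and "psd W" and "P \<bullet> W = 0"
  shows "rank P + rank W \<le> CARD('n)"
proof -
  have "P ** W = 0"
    by (rule psd_inner_eq_0_imp_mult_eq_0[OF assms])
  have orth: "x \<bullet> y = 0" if xP: "x \<in> range ((*v) P)" and yW: "y \<in> range ((*v) W)" for x y
  proof -
    obtain a c where "x = P *v a" "y = W *v c"
      using xP yW by blast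
    then have "x \<bullet> y = a \<bullet> ((P ** W) *v c)"
      using psdP sym_mat_inner_mult[of P a "W *v c"]
      unfolding psd_def by (simp add: matrix_vector_mul_assoc)
    with \<open>P ** W = 0\<close> show ?thesis
      by simp
  qed
  have "rank P + rank W = dim (range ((*v) P) \<union> range ((*v) W))"
    unfolding rank_dim_range by (rule dim_orthogonal_sum[symmetric]) (rule orth)
  also have "\<dots> \<le> CARD('n)"
    by (rule dim_subset_UNIV_cart)
  finally show ?thesis .
qed

section \<open>Projection onto the PSD cone\<close>

lemma closed_psd: "closed {X::real^'n^'n. psd X}"
proof -
  have "{X::real^'n^'n. psd X} = {X. (\<forall>i j. X $ i $ j = X $ j $ i) \<and> (\<forall>v. 0 \<le> v \<bullet> (X *v v))}"
    unfolding psd_def sym_mat_iff ..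
  also have "closed \<dots>"
    unfolding matrix_vector_mult_def inner_vec_def
    by (intro closed_Collect_conj closed_Collect_all closed_Collect_eq closed_Collect_le continuous_intros)
  finally show ?thesis .
qed

lemma convex_psd: "convex {X::real^'n^'n. psd X}"
  unfolding convex_def by (simp add: psd_add psd_scaleR)

lemma psd_proj_eq_closest_point: "psd_proj Z = closest_point {X. psd X} Z"
  unfolding psd_proj_def
proof (rule the_equality)
  show "psd (closest_point {X. psd X} Z) \<and>
      (\<forall>Y. psd Y \<longrightarrow> norm (Z - closest_point {X. psd X} Z) \<le> norm (Z - Y))"
    using closest_point_exists[OF closed_psd, of Z] psd_zero by (auto simp: dist_norm)
  fix X
  assume "psd X \<and> (\<forall>Y. psd Y \<longrightarrow> norm (Z - X) \<le> norm (Z - Y))"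
  then show "X = closest_point {X. psd X} Z"
    by (intro closest_point_unique[OF convex_psd closed_psd]) (auto simp: dist_norm)
qed

lemma psd_psd_proj: "psd (psd_proj Z)"
  unfolding psd_proj_eq_closest_point using closest_point_exists[OF closed_psd] psd_zero by auto

lemma tendsto_psd_proj: "(f \<longlongrightarrow> Z) F \<Longrightarrow> ((\<lambda>x. psd_proj (f x)) \<longlongrightarrow> psd_proj Z) F"
  unfolding psd_proj_eq_closest_point
  by (rule isCont_tendsto_compose[OF continuous_at_closest_point[OF convex_psd closed_psd]])
    (use psd_zero in auto)

lemma psd_proj_eqI:
  fixes X Z :: "real^'n^'n"
  assumes "psd X" and obtuse: "\<And>Y. psd Y \<Longrightarrow> (Z - X) \<bullet> (Y - X) \<le> 0"
  shows "psd_proj Z = X"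
proof -
  have "dist Z X \<le> dist Z Y" if "psd Y" for Y
  proof -
    have "(norm (Z - Y))\<^sup>2 = (norm (Z - X))\<^sup>2 - 2 * ((Z - X) \<bullet> (Y - X)) + (norm (Y - X))\<^sup>2"
      by (simp add: power2_norm_eq_inner inner_diff_left inner_diff_right inner_commute algebra_simps)
    then have "(norm (Z - X))\<^sup>2 \<le> (norm (Z - Y))\<^sup>2"
      using obtuse[OF that] zero_le_power2[of "norm (Y - X)"] by linarith
    then show ?thesis
      by (simp add: dist_norm power_mono_iff)
  qed
  then have "X = closest_point {X. psd X} Z"
    using \<open>psd X\<close> by (intro closest_point_unique[OF convex_psd closed_psd]) auto
  then show ?thesis
    by (simp add: psd_proj_eq_closest_point)
qed

lemma psd_proj_diff_of_inner_eq_0: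
  assumes "psd X" "psd S" "X \<bullet> S = 0"
  shows "psd_proj (X - S) = X"
  using assms psd_inner_nonneg[OF assms(2)]
  by (intro psd_proj_eqI) (simp_all add: inner_diff_right inner_commute)

lemma psd_proj_Moreau:
  fixes Z :: "real^'n^'n"
  assumes "sym_mat Z"
  shows "psd (psd_proj Z - Z)" and "psd_proj Z \<bullet> (psd_proj Z - Z) = 0"
proof -
  define P where "P = psd_proj Z"
  have "psd P"
    unfolding P_def by (rule psd_psd_proj)
  have obtuse: "(Z - P) \<bullet> (Y - P) \<le> 0" if "psd Y" for Y
    unfolding P_def psd_proj_eq_closest_point using that
    by (intro closest_point_dot[OF convex_psd closed_psd]) simp
  have "0 \<le> v \<bullet> ((P - Z) *v v)" for v
    using obtuse[OF psd_add[OF \<open>psd P\<close> psd_outer[of v]]]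
    by (simp add: inner_diff_left inner_outer matrix_vector_mult_diff_rdistrib inner_diff_right)
  moreover have "sym_mat (P - Z)"
    using \<open>psd P\<close> assms unfolding psd_def by (simp add: sym_mat_diff)
  ultimately show "psd (psd_proj Z - Z)"
    unfolding psd_def P_def by simp
  have "(Z - P) \<bullet> (0 - P) \<le> 0" and "(Z - P) \<bullet> (2 *\<^sub>R P - P) \<le> 0"
    using obtuse[OF psd_zero] obtuse[OF psd_scaleR[OF \<open>psd P\<close>, of 2]] by simp_all
  then show "psd_proj Z \<bullet> (psd_proj Z - Z) = 0"
    unfolding P_def[symmetric] by (simp add: inner_diff_left inner_diff_right scaleR_2 inner_commute)
qed

lemma psd_proj_uminus:
  fixes Z :: "real^'n^'n"
  assumes "sym_mat Z"
  shows "psd_proj (- Z) = psd_proj Z - Z"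
proof -
  have "- Z = (psd_proj Z - Z) - psd_proj Z"
    by simp
  also have "psd_proj \<dots> = psd_proj Z - Z"
    using psd_proj_Moreau[OF assms]
    by (intro psd_proj_diff_of_inner_eq_0 psd_psd_proj) (simp_all add: inner_commute)
  finally show ?thesis .
qed

lemma rank_psd_proj_add_rank_psd_proj_uminus_le:
  fixes Z :: "real^'n^'n"
  assumes "sym_mat Z"
  shows "rank (psd_proj Z) + rank (psd_proj (- Z)) \<le> CARD('n)"
  unfolding psd_proj_uminus[OF assms]
  by (rule rank_add_rank_le_of_psd_inner_eq_0[OF psd_psd_proj psd_proj_Moreau[OF assms]])

section \<open>Lower semicontinuity of rank\<close>

lemma norm_matrix_vector_mult_le: "norm ((A::real^'n^'m) *v x) \<le> norm A * norm x"
proof -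
  have "norm (A *v x) \<le> L2_set (\<lambda>i. norm (A $ i) * norm x) UNIV"
    unfolding norm_vec_def[of "A *v x"]
    by (rule L2_set_mono) (simp_all add: matrix_mult_dot Cauchy_Schwarz_ineq2)
  also have "\<dots> = norm A * norm x"
    unfolding norm_vec_def[of A] by (simp add: L2_set_left_distrib)
  finally show ?thesis .
qed

lemma matrix_bounded_below_on_row_space:
  fixes M :: "real^'n^'m"
  obtains c where "0 < c" and "\<And>v. v \<in> range ((*v) (transpose M)) \<Longrightarrow> c * norm v \<le> norm (M *v v)"
proof -
  define V where "V = range ((*v) (transpose M))"
  have "subspace V"
    unfolding V_def by (rule linear_subspace_image) auto
  have "v = 0" if "v \<in> V" "M *v v = 0" for v
  proof -
    obtain w where "v = transpose M *v w"
      using \<open>v \<in> V\<close> unfolding V_def by blast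
    then have "v \<bullet> v = w \<bullet> (M *v v)"
      by (simp add: dot_lmul_matrix)
    with \<open>M *v v = 0\<close> show ?thesis
      by simp
  qed
  with injective_imp_isometric[OF closed_subspace[OF \<open>subspace V\<close>] \<open>subspace V\<close>
      matrix_vector_mul_bounded_linear] that
  show thesis
    unfolding V_def by blast
qed

lemma rank_lower_semicontinuous:
  fixes M :: "real^'n^'m"
  assumes "(f \<longlongrightarrow> M) F"
  shows "\<forall>\<^sub>F k in F. rank M \<le> rank (f k)"
proof -
  define V where "V = range ((*v) (transpose M))"
  have "subspace V"
    unfolding V_def by (rule linear_subspace_image) auto
  obtain c where "0 < c" and bounded_below: "\<And>v. v \<in> V \<Longrightarrow> c * norm v \<le> norm (M *v v)"
    using matrix_bounded_below_on_row_space[of M] unfolding V_def by blast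
  from assms \<open>0 < c\<close> have "\<forall>\<^sub>F k in F. dist (f k) M < c"
    by (rule tendstoD)
  then show ?thesis
  proof (rule eventually_mono)
    fix k
    assume close: "dist (f k) M < c"
    have "v = 0" if "v \<in> V" "f k *v v = 0" for v
    proof (rule ccontr)
      assume "v \<noteq> 0"
      have "c * norm v \<le> norm ((M - f k) *v v)"
        using bounded_below[OF \<open>v \<in> V\<close>] \<open>f k *v v = 0\<close> by (simp add: matrix_vector_mult_diff_rdistrib)
      also have "\<dots> \<le> norm (M - f k) * norm v"
        by (rule norm_matrix_vector_mult_le)
      also have "\<dots> < c * norm v"
        using close \<open>v \<noteq> 0\<close> by (simp add: dist_norm norm_minus_commute)
      finally show False
        by simp
    qed
    then have "inj_on ((*v) (f k)) (span V)"
      using \<open>subspace V\<close> by (simp add: linear_inj_on_iff_eq_0 span_eq_iff[THEN iffD2])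
    have "rank M = dim V"
      unfolding V_def rank_dim_range[symmetric] rank_transpose ..
    also have "\<dots> = dim ((*v) (f k) ` V)"
      by (rule dim_image_eq[symmetric]) (simp_all add: \<open>inj_on ((*v) (f k)) (span V)\<close>)
    also have "\<dots> \<le> rank (f k)"
      unfolding rank_dim_range by (rule dim_subset) auto
    finally show "rank M \<le> rank (f k)" .
  qed
qed

lemma rank_scaleR:
  fixes M :: "real^'n^'m"
  assumes "c \<noteq> 0"
  shows "rank (c *\<^sub>R M) = rank M"
proof -
  have scale: "(c *\<^sub>R M) *v x = M *v (c *\<^sub>R x)" for x
    by (simp add: matrix_scaleR_vector_ac)
  have unscale: "M *v x = (c *\<^sub>R M) *v (inverse c *\<^sub>R x)" for x
    using assms by (simp add: scale)
  have "range ((*v) (c *\<^sub>R M)) = range ((*v) M)"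
    by (intro equalityI image_subsetI) (metis rangeI scale unscale)+
  then show ?thesis
    by (simp add: rank_dim_range)
qed

section \<open>Rank identification for ADMM\<close>

lemma sym_mat_admm_step:
  assumes "\<And>i. sym_mat (A i)" "sym_mat C" "sym_mat Z"
  shows "sym_mat (admm_step A b C \<sigma> Z)"
proof -
  have "sym_mat (psd_proj Z)"
    using psd_psd_proj unfolding psd_def by blast
  with assms show ?thesis
    unfolding admm_step_def Pproj_def by (intro sym_mat_add sym_mat_diff sym_mat_scaleR sym_mat_Aadj) auto
qed

lemma tendsto_admm_X_admm_S:
  assumes psdX: "psd X" and psdS: "psd S" and orth: "X \<bullet> S = 0" and "0 < \<sigma>"
    and conv: "(Z \<longlongrightarrow> X - \<sigma> *\<^sub>R S) F"
  shows "((\<lambda>k. admm_X (Z k)) \<longlongrightarrow> X) F" and "((\<lambda>k. admm_S \<sigma> (Z k)) \<longlongrightarrow> S) F"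
proof -
  have "((\<lambda>k. admm_X (Z k)) \<longlongrightarrow> psd_proj (X - \<sigma> *\<^sub>R S)) F"
    unfolding admm_X_def by (rule tendsto_psd_proj[OF conv])
  also have "psd_proj (X - \<sigma> *\<^sub>R S) = X"
    using psdX psdS \<open>0 < \<sigma>\<close> orth by (intro psd_proj_diff_of_inner_eq_0 psd_scaleR) auto
  finally show "((\<lambda>k. admm_X (Z k)) \<longlongrightarrow> X) F" .
  have "((\<lambda>k. admm_S \<sigma> (Z k)) \<longlongrightarrow> inverse \<sigma> *\<^sub>R psd_proj (\<sigma> *\<^sub>R S - X)) F"
    unfolding admm_S_def using tendsto_psd_proj[OF tendsto_minus[OF conv]]
    by (intro tendsto_scaleR tendsto_const) simp
  also have "psd_proj (\<sigma> *\<^sub>R S - X) = \<sigma> *\<^sub>R S"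
    using psdX psdS \<open>0 < \<sigma>\<close> orth by (intro psd_proj_diff_of_inner_eq_0 psd_scaleR) (auto simp: inner_commute)
  finally show "((\<lambda>k. admm_S \<sigma> (Z k)) \<longlongrightarrow> S) F"
    using \<open>0 < \<sigma>\<close> by simp
qed

lemma rank_admm_X_add_rank_admm_S_le:
  fixes Z :: "real^'n^'n"
  assumes "sym_mat Z" "\<sigma> \<noteq> 0"
  shows "rank (admm_X Z) + rank (admm_S \<sigma> Z) \<le> CARD('n)"
  using rank_psd_proj_add_rank_psd_proj_uminus_le[OF assms(1)] assms(2)
  unfolding admm_X_def admm_S_def by (simp add: rank_scaleR)

theorem proposition3:
  fixes A :: "'m::finite \<Rightarrow> real^'n^'n" and b :: "real^'m" and C :: "real^'n^'n"
    and \<sigma> :: real and Z :: "nat \<Rightarrow> real^'n^'n"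
    and Xs :: "real^'n^'n" and ys :: "real^'m" and Ss :: "real^'n^'n"
  assumes symA: "\<And>i. sym_mat (A i)" and symC: "sym_mat C"
    and surjA: "\<forall>c. \<exists>X. sym_mat X \<and> Aop A X = c"
    and sigma_pos: "\<sigma> > 0"
    and Z0: "sym_mat (Z 0)"
    and iter: "\<And>k. Z (Suc k) = admm_step A b C \<sigma> (Z k)"
    and kkt: "is_KKT A b C Xs ys Ss"
    and conv: "Z \<longlonglongrightarrow> Xs - \<sigma> *\<^sub>R Ss"
    and strict: "rank Xs + rank Ss = CARD('n)"
  shows "\<exists>kID::nat. \<forall>k\<ge>kID. rank (admm_X (Z k)) = rank Xs \<and> rank (admm_S \<sigma> (Z k)) = rank Ss"
proof -
  have psdX: "psd Xs" and psdS: "psd Ss" and "trace (Xs ** Ss) = 0"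
    using kkt unfolding is_KKT_def by auto
  then have "Xs \<bullet> Ss = 0"
    using trace_mult_sym_mat[of Ss Xs] unfolding psd_def by simp
  note lim = tendsto_admm_X_admm_S[OF psdX psdS this sigma_pos conv]
  have "sym_mat (Z k)" for k
    by (induction k) (simp_all add: Z0 iter sym_mat_admm_step symA symC)
  then have upper: "rank (admm_X (Z k)) + rank (admm_S \<sigma> (Z k)) \<le> CARD('n)" for k
    using sigma_pos by (simp add: rank_admm_X_add_rank_admm_S_le)
  have "\<forall>\<^sub>F k in sequentially. rank Xs \<le> rank (admm_X (Z k)) \<and> rank Ss \<le> rank (admm_S \<sigma> (Z k))"
    using rank_lower_semicontinuous[OF lim(1)] rank_lower_semicontinuous[OF lim(2)]
    by (rule eventually_conj)
  then obtain kID where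
    lower: "\<And>k. kID \<le> k \<Longrightarrow> rank Xs \<le> rank (admm_X (Z k)) \<and> rank Ss \<le> rank (admm_S \<sigma> (Z k))"
    unfolding eventually_sequentially by blast
  have "rank (admm_X (Z k)) = rank Xs \<and> rank (admm_S \<sigma> (Z k)) = rank Ss" if "kID \<le> k" for k
    using lower[OF that] upper[of k] strict by linarith
  then show ?thesis
    by blast
qed

end
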